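(* Let $p,q\geq 2$ be integers. Then the degree of a $p\times q$ rectangular band is equal to \[ \beta(p,q)=\min_{r\geq 2}\beta_r(p,q),\qquad\text{where}\qquad \beta_r(p,q)=\min\bigl\{\,n\in\mathbb N : \pi_r\bigl(n-\lceil\log_r p\rceil\bigr)\geq q\,\bigr\}\ \text{ for } r\geq 2 . \]
   Context: For $n\in\mathbb N$, $\mathcal T_n$ denotes the full transformation semigroup of all maps $\{1,\dots,n\}\to\{1,\dots,n\}$ under composition. The degree $\mu(S)$ of a finite semigroup $S$ is the least $n\geq 1$ such that $S$ embeds (as a subsemigroup, up to isomorphism) in $\mathcal T_n$. A $p\times q$ rectangular band is a semigroup $P\times Q$ with $|P|=p$, $|Q|=q$ and multiplication $(p_1,q_1)(p_2,q_2)=(p_1,q_2)$. A composition of $m\in\mathbb N$ of length $r$ is a tuple $(s_1,\dots,s_r)$ of positive integers with $s_1+\cdots+s_r=m$; for $1\leq r\leq m$, $\pi_r(m)$ is the maximum of the products $s_1\cdots s_r$ over all compositions $(s_1,\dots,s_r)$ of $m$ of length $r$ (the condition $\pi_r(m)\geq q$ is understood to fail when $m<r$, as there are then no such compositions). *)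

theory Defs
  imports Complex_Main "HOL-Library.FuncSet"
begin

definition semigroup_embedding ::
  "'a set \<Rightarrow> ('a \<Rightarrow> 'a \<Rightarrow> 'a) \<Rightarrow> 'b set \<Rightarrow> ('b \<Rightarrow> 'b \<Rightarrow> 'b) \<Rightarrow> ('a \<Rightarrow> 'b) \<Rightarrow> bool" where
  "semigroup_embedding S f T g h \<longleftrightarrow>
     h \<in> S \<rightarrow> T \<and> inj_on h S \<and> (\<forall>x\<in>S. \<forall>y\<in>S. h (f x y) = g (h x) (h y))"

definition full_trans :: "nat \<Rightarrow> (nat \<Rightarrow> nat) set" where
  "full_trans n = {1..n} \<rightarrow>\<^sub>E {1..n}"

text \<open>Transformations act on the right and are composed from left to right: the product
  of \<open>f\<close> and \<open>g\<close> maps \<open>x\<close> to \<open>g (f x)\<close>. The order matters: composing from right to left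
  replaces each semigroup by its dual, hence swaps the two parameters of a rectangular
  band, and the degree of a rectangular band is not symmetric in these.\<close>

definition trans_mult :: "nat \<Rightarrow> (nat \<Rightarrow> nat) \<Rightarrow> (nat \<Rightarrow> nat) \<Rightarrow> (nat \<Rightarrow> nat)" where
  "trans_mult n f g = compose {1..n} g f"

definition semigroup_degree :: "'a set \<Rightarrow> ('a \<Rightarrow> 'a \<Rightarrow> 'a) \<Rightarrow> nat" where
  "semigroup_degree S f =
     (LEAST n. 1 \<le> n \<and> (\<exists>h. semigroup_embedding S f (full_trans n) (trans_mult n) h))"

definition rect_mult :: "'a \<times> 'b \<Rightarrow> 'a \<times> 'b \<Rightarrow> 'a \<times> 'b" where
  "rect_mult x y = (fst x, snd y)"

definition compositions :: "nat \<Rightarrow> nat \<Rightarrow> nat list set" where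
  "compositions r m = {s. length s = r \<and> (\<forall>x\<in>set s. 1 \<le> x) \<and> sum_list s = m}"

text \<open>Only meaningful for \<open>1 \<le> r \<le> m\<close>, when the set of compositions is finite and nonempty.\<close>

definition max_comp_prod :: "nat \<Rightarrow> nat \<Rightarrow> nat" where
  "max_comp_prod r m = Max (prod_list ` compositions r m)"

text \<open>The first conjunct makes the condition fail when no composition of length \<open>r\<close> exists.\<close>

definition beta_r :: "nat \<Rightarrow> nat \<Rightarrow> nat \<Rightarrow> nat" where
  "beta_r r p q =
     (LEAST n. int r \<le> int n - \<lceil>log (real r) (real p)\<rceil> \<and>
               q \<le> max_comp_prod r (nat (int n - \<lceil>log (real r) (real p)\<rceil>)))"

definition beta :: "nat \<Rightarrow> nat \<Rightarrow> nat" where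
  "beta p q = (LEAST b. \<exists>r\<ge>2. b = beta_r r p q)"

end

theory Submission imports Defs begin

text \<open>In a rectangular band of transformations, \<open>e\<^sub>i\<^sub>j\<close> is determined by its kernel, which depends
  only on \<open>i\<close>, and its image, which depends only on \<open>j\<close>. Let \<open>X\<close> be the union of all images and
  \<open>r\<close> the common rank. On \<open>X\<close> all kernels agree, with classes of sizes \<open>s\<^sub>1, \<dots>, s\<^sub>r\<close> say; every
  image is a transversal of these classes, so \<open>q \<le> s\<^sub>1 \<cdots> s\<^sub>r\<close>. A kernel is then determined by
  the classes to which the \<open>c\<close> points outside \<open>X\<close> are attached, so \<open>p \<le> r ^ c\<close>. Conversely any
  such data on \<open>s\<^sub>1 + \<cdots> + s\<^sub>r + c\<close> points yield an embedding.\<close>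

section \<open>Logarithms and maximal products of compositions\<close>

lemma ceiling_log_le_iff:
  fixes r p c :: nat
  assumes "r \<ge> 2" "p \<ge> 1"
  shows "\<lceil>log (real r) (real p)\<rceil> \<le> int c \<longleftrightarrow> p \<le> r ^ c"
proof -
  have "\<lceil>log (real r) (real p)\<rceil> \<le> int c \<longleftrightarrow> log (real r) (real p) \<le> real c"
    by (simp add: ceiling_le_iff)
  also have "\<dots> \<longleftrightarrow> real p \<le> real r powr real c"
    using assms by (subst log_le_iff) auto
  also have "\<dots> \<longleftrightarrow> real p \<le> real (r ^ c)"
    using assms by (simp add: powr_realpow)
  finally show ?thesis by linarith
qed

lemma length_le_sum_list:
  fixes s :: "nat list"
  assumes "\<forall>x\<in>set s. 1 \<le> x"
  shows "length s \<le> sum_list s"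
  using assms by (induction s) auto

lemma finite_compositions: "finite (compositions r m)"
proof (rule finite_subset)
  show "compositions r m \<subseteq> {s. set s \<subseteq> {..m} \<and> length s = r}"
    by (auto simp: compositions_def member_le_sum_list)
  show "finite {s::nat list. set s \<subseteq> {..m} \<and> length s = r}"
    by (rule finite_lists_length_eq) simp
qed

lemma compositions_nonempty:
  assumes "1 \<le> r" "r \<le> m"
  shows "compositions r m \<noteq> {}"
proof -
  have "(m - (r - 1)) # replicate (r - 1) 1 \<in> compositions r m"
    using assms by (auto simp: compositions_def sum_list_replicate)
  then show ?thesis by blast
qed

lemma compositions_extend:
  assumes "s \<in> compositions r k" "1 \<le> r" "k \<le> m"
  shows "\<exists>t\<in>compositions r m. prod_list s \<le> prod_list t"
proof -
  obtain x xs where s: "s = x # xs"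
    using assms by (cases s) (auto simp: compositions_def)
  have "(x + (m - k)) # xs \<in> compositions r m"
    using assms s by (auto simp: compositions_def)
  moreover have "prod_list s \<le> prod_list ((x + (m - k)) # xs)"
    by (simp add: s)
  ultimately show ?thesis by blast
qed

lemma le_max_comp_prod_iff:
  assumes "1 \<le> r" "r \<le> m"
  shows "q \<le> max_comp_prod r m \<longleftrightarrow> (\<exists>s\<in>compositions r m. q \<le> prod_list s)"
  unfolding max_comp_prod_def
  using assms by (subst Max_ge_iff) (auto simp: finite_compositions compositions_nonempty)

section \<open>The formula for \<open>beta\<close> in combinatorial form\<close>

text \<open>The condition in \<open>beta_r\<close> without logarithm or maximum, in the form in
  which an embedding delivers it: \<open>s\<close> lists the sizes of the kernel classes on the
  union of the images, and \<open>c\<close> counts the points outside this union. Here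
  \<open>c\<close> may exceed the ceiling of the logarithm.\<close>

definition band_data :: "nat \<Rightarrow> nat \<Rightarrow> nat \<Rightarrow> nat \<Rightarrow> bool" where
  "band_data r p q n \<longleftrightarrow>
     (\<exists>s c. s \<in> compositions r (n - c) \<and> c \<le> n \<and> q \<le> prod_list s \<and> p \<le> r ^ c)"

lemma beta_r_condition_iff:
  assumes "r \<ge> 2" "p \<ge> 1"
  shows "int r \<le> int n - \<lceil>log (real r) (real p)\<rceil> \<and>
           q \<le> max_comp_prod r (nat (int n - \<lceil>log (real r) (real p)\<rceil>))
         \<longleftrightarrow> band_data r p q n" (is "?C \<longleftrightarrow> _")
proof -
  have "0 \<le> log (real r) (real p)"
    using assms by simp
  then have "0 \<le> \<lceil>log (real r) (real p)\<rceil>"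
    by (simp add: zero_le_ceiling)
  then obtain c where c: "\<lceil>log (real r) (real p)\<rceil> = int c"
    using nonneg_int_cases by blast
  have C: "?C \<longleftrightarrow> c \<le> n \<and> r \<le> n - c \<and> (\<exists>s\<in>compositions r (n - c). q \<le> prod_list s)"
  proof (cases "c \<le> n \<and> r \<le> n - c")
    case True
    then show ?thesis
      using le_max_comp_prod_iff[of r "n - c" q] assms
      by (auto simp: c nat_diff_distrib)
  next
    case False
    then show ?thesis using assms by (auto simp: c)
  qed
  show ?thesis
  proof
    assume ?C
    moreover have "p \<le> r ^ c"
      using ceiling_log_le_iff[OF assms, of c] c by simp
    ultimately show "band_data r p q n"
      unfolding C band_data_def by blast
  next
    assume "band_data r p q n"
    then obtain s d where s: "s \<in> compositions r (n - d)" "d \<le> n" "q \<le> prod_list s" "p \<le> r ^ d"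
      unfolding band_data_def by blast
    \<comment> \<open>The ceiling \<open>c\<close> is the least exponent with
      \<open>p \<le> r ^ c\<close>, so the given \<open>d\<close> is at least \<open>c\<close>; the
      \<open>d - c\<close> points gained by passing to \<open>c\<close> are absorbed into the
      composition.\<close>
    have cd: "c \<le> d"
      using ceiling_log_le_iff[OF assms, of d] c s by simp
    have rd: "r \<le> n - d"
      using s(1) length_le_sum_list[of s] by (auto simp: compositions_def)
    obtain t where "t \<in> compositions r (n - c)" "prod_list s \<le> prod_list t"
      using compositions_extend[OF s(1), of "n - c"] assms diff_le_mono2[OF cd] by auto
    then show ?C
      unfolding C using s cd rd by (intro conjI bexI[of _ t]) auto
  qed
qed

text \<open>The crude choice of parts \<open>q, 1, \<dots>, 1\<close> and \<open>c = p\<close>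
  suffices. This guarantees that the \<open>LEAST\<close> in \<open>beta_r\<close> is
  attained.\<close>

lemma band_data_exists:
  assumes "r \<ge> 2" "q \<ge> 1"
  shows "\<exists>n. band_data r p q n"
proof -
  have "q # replicate (r - 1) 1 \<in> compositions r (q + (r - 1) + p - p)"
    using assms by (auto simp: compositions_def sum_list_replicate)
  moreover have "p \<le> r ^ p"
    using assms by (simp add: less_imp_le self_le_ge2_pow)
  ultimately show ?thesis
    unfolding band_data_def
    by (intro exI[of _ "q + (r - 1) + p"] exI[of _ "q # replicate (r - 1) 1"] exI[of _ p]) simp
qed

text \<open>Each inner minimum over \<open>n\<close> is attained, so minimizing first over
  \<open>n\<close> and then over \<open>r\<close> amounts to minimizing over both at once.\<close>

lemma beta_eq_Least_band_data:
  assumes "p \<ge> 1" "q \<ge> 1"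
  shows "beta p q = (LEAST n. \<exists>r\<ge>2. band_data r p q n)"
proof -
  have b: "beta_r r p q = (LEAST n. band_data r p q n)" if "r \<ge> 2" for r
    unfolding beta_r_def using beta_r_condition_iff[OF that assms(1)] by simp
  have bd: "band_data r p q (beta_r r p q)" if "r \<ge> 2" for r
    using band_data_exists[OF that assms(2), of p] b[OF that] LeastI_ex by metis
  define N where "N = (LEAST n. \<exists>r\<ge>2. band_data r p q n)"
  have "\<exists>r\<ge>2. band_data r p q N"
    unfolding N_def by (rule LeastI_ex) (use bd in blast)
  then obtain r where r: "r \<ge> 2" "band_data r p q N" by blast
  have min: "N \<le> beta_r t p q" if "t \<ge> 2" for t
    unfolding N_def by (rule Least_le) (use bd that in blast)
  have "beta_r r p q \<le> N"
    unfolding b[OF r(1)] using r(2) by (rule Least_le)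
  then have "beta_r r p q = N" using min[OF r(1)] by simp
  then have "beta p q = N"
    unfolding beta_def using min r(1) by (intro Least_equality) auto
  then show ?thesis unfolding N_def .
qed

section \<open>Lower bound: data extracted from an embedding\<close>

lemma band_data_of_embedding:
  fixes P :: "'a set" and Q :: "'b set"
  assumes p: "card P \<ge> 2" and q: "card Q \<ge> 1"
    and emb: "semigroup_embedding (P \<times> Q) rect_mult (full_trans n) (trans_mult n) h"
  shows "\<exists>r\<ge>2. band_data r (card P) (card Q) n"
proof -
  let ?N = "{1..n}"
  obtain i\<^sub>0 where i0: "i\<^sub>0 \<in> P" using p by fastforce
  obtain j\<^sub>0 where j0: "j\<^sub>0 \<in> Q" using q by fastforce
  have hE: "h (i, j) \<in> ?N \<rightarrow>\<^sub>E ?N" if "i \<in> P" "j \<in> Q" for i j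
    using emb that by (auto simp: semigroup_embedding_def full_trans_def)
  have hN: "h (i, j) x \<in> ?N" if "i \<in> P" "j \<in> Q" "x \<in> ?N" for i j x
    using hE[OF that(1,2)] that(3) by (rule PiE_mem)
  have mult: "h (k, l) (h (i, j) x) = h (i, l) x"
    if "i \<in> P" "j \<in> Q" "k \<in> P" "l \<in> Q" "x \<in> ?N" for i j k l x
  proof -
    have "h (rect_mult (i, j) (k, l)) = trans_mult n (h (i, j)) (h (k, l))"
      using emb that unfolding semigroup_embedding_def by blast
    then have "h (i, l) = compose ?N (h (k, l)) (h (i, j))"
      by (simp add: rect_mult_def trans_mult_def)
    then show ?thesis using that(5) by (simp add: compose_def)
  qed
  have inj: "inj_on h (P \<times> Q)"
    using emb by (simp add: semigroup_embedding_def)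
  \<comment> \<open>The idempotent \<open>e\<close> serves as base point. Its image \<open>A\<close>
    labels the kernel classes on \<open>X\<close>: the class with label \<open>a\<close> is the
    fibre \<open>B a\<close>, and it contains \<open>a\<close> itself.\<close>
  define e where "e = h (i\<^sub>0, j\<^sub>0)"
  define A where "A = e ` ?N"
  define X where "X = (\<Union>u\<in>P \<times> Q. h u ` ?N)"
  define B where "B a = {x \<in> X. e x = a}" for a
  define c where "c = card (?N - X)"
  have X: "X \<subseteq> ?N" unfolding X_def using hN by blast
  then have finX: "finite X" by (rule finite_subset) simp
  have finB: "finite (B a)" for a unfolding B_def using finX by simp
  have finA: "finite A" by (simp add: A_def)
  have A: "A \<subseteq> X" unfolding A_def X_def e_def using i0 j0 by blast
  have eA: "e a = a" if "a \<in> A" for a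
    using that mult[OF i0 j0 i0 j0] by (auto simp: A_def e_def)
  have Bge: "1 \<le> card (B a)" if "a \<in> A" for a
    using that A eA finB[of a] by (auto simp: B_def Suc_le_eq card_gt_0_iff)
  \<comment> \<open>The image of \<open>h (i\<^sub>0, j)\<close> meets each class \<open>B a\<close>
    in the image of \<open>a\<close>, so \<open>j\<close> gives a choice function. That function
    determines \<open>h (i\<^sub>0, j)\<close>, because this map is unchanged by first applying
    \<open>e\<close>.\<close>
  have "card Q \<le> card (PiE A B)"
  proof (rule card_inj_on_le)
    show "(\<lambda>j. restrict (h (i\<^sub>0, j)) A) ` Q \<subseteq> PiE A B"
    proof (intro subsetI, elim imageE, simp only:, intro restrict_PiE_iff[THEN iffD2] ballI)
      fix j a assume j: "j \<in> Q" and a: "a \<in> A"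
      have aN: "a \<in> ?N" using a A X by blast
      have "h (i\<^sub>0, j) a \<in> X" unfolding X_def using i0 j aN by blast
      moreover have "e (h (i\<^sub>0, j) a) = a"
        using mult[OF i0 j i0 j0 aN] eA[OF a] by (simp add: e_def)
      ultimately show "h (i\<^sub>0, j) a \<in> B a" by (simp add: B_def)
    qed
    show "inj_on (\<lambda>j. restrict (h (i\<^sub>0, j)) A) Q"
    proof (rule inj_onI)
      fix j l assume j: "j \<in> Q" and l: "l \<in> Q"
        and eq: "restrict (h (i\<^sub>0, j)) A = restrict (h (i\<^sub>0, l)) A"
      have "h (i\<^sub>0, j) = h (i\<^sub>0, l)"
      proof (rule PiE_ext[OF hE[OF i0 j] hE[OF i0 l]])
        fix x assume x: "x \<in> ?N"
        then have "e x \<in> A" by (simp add: A_def)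
        then have "h (i\<^sub>0, j) (e x) = h (i\<^sub>0, l) (e x)"
          using eq by (metis restrict_apply')
        then show "h (i\<^sub>0, j) x = h (i\<^sub>0, l) x"
          using mult[OF i0 j0 i0 j x] mult[OF i0 j0 i0 l x] by (simp add: e_def)
      qed
      then show "j = l" using inj i0 j l by (auto dest: inj_onD)
    qed
    show "finite (PiE A B)" using finA finB by (simp add: finite_PiE)
  qed
  then have qB: "card Q \<le> (\<Prod>a\<in>A. card (B a))"
    using finA by (simp add: card_PiE)
  \<comment> \<open>All \<open>h (i, j\<^sub>0)\<close> take values in \<open>A\<close>, being fixed
    under a subsequent \<open>e\<close>. They can differ only outside \<open>X\<close>.\<close>
  have "card P \<le> card ((?N - X) \<rightarrow>\<^sub>E A)"
  proof (rule card_inj_on_le)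
    show "(\<lambda>i. restrict (h (i, j\<^sub>0)) (?N - X)) ` P \<subseteq> (?N - X) \<rightarrow>\<^sub>E A"
    proof (intro subsetI, elim imageE, simp only:, intro restrict_PiE_iff[THEN iffD2] ballI)
      fix i y assume i: "i \<in> P" and y: "y \<in> ?N - X"
      then have "h (i, j\<^sub>0) y = e (h (i, j\<^sub>0) y)"
        using mult[OF i j0 i0 j0] by (simp add: e_def)
      then show "h (i, j\<^sub>0) y \<in> A"
        unfolding A_def using hN[OF i j0] y by (metis DiffD1 imageI)
    qed
    show "inj_on (\<lambda>i. restrict (h (i, j\<^sub>0)) (?N - X)) P"
    proof (rule inj_onI)
      fix i k assume i: "i \<in> P" and k: "k \<in> P"
        and eq: "restrict (h (i, j\<^sub>0)) (?N - X) = restrict (h (k, j\<^sub>0)) (?N - X)"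
      have "h (i, j\<^sub>0) = h (k, j\<^sub>0)"
      proof (rule PiE_ext[OF hE[OF i j0] hE[OF k j0]])
        fix x assume x: "x \<in> ?N"
        show "h (i, j\<^sub>0) x = h (k, j\<^sub>0) x"
        proof (cases "x \<in> X")
          case True
          \<comment> \<open>A point of \<open>X\<close> is already a value of some
            \<open>h (i', j')\<close>, and in the product the left factor's \<open>i'\<close>
            overrides \<open>i\<close> and \<open>k\<close>.\<close>
          then obtain i' j' y where "i' \<in> P" "j' \<in> Q" "y \<in> ?N" "x = h (i', j') y"
            unfolding X_def by blast
          then show ?thesis
            using mult[of i' j' i j\<^sub>0 y] mult[of i' j' k j\<^sub>0 y] i k j0 by simp
        next
          case False
          then show ?thesis using x eq by (metis DiffI restrict_apply')
        qed
      qed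
      then show "i = k" using inj j0 i k by (auto dest: inj_onD)
    qed
    show "finite ((?N - X) \<rightarrow>\<^sub>E A)" using finA by (simp add: finite_PiE)
  qed
  then have pc: "card P \<le> card A ^ c"
    by (simp add: card_PiE c_def)
  \<comment> \<open>Rank at most 1 would leave room for a single kernel only, against
    \<open>card P \<ge> 2\<close>.\<close>
  have r: "card A \<ge> 2"
  proof (rule ccontr)
    assume "\<not> card A \<ge> 2"
    then have "card A ^ c \<le> 1 ^ c" by (intro power_mono) auto
    then show False using pc p by simp
  qed
  obtain as where as: "set as = A" "distinct as"
    using finite_distinct_list[OF finA] by blast
  define s where "s = map (\<lambda>a. card (B a)) as"
  \<comment> \<open>Since \<open>e\<close> maps \<open>X\<close> into \<open>A\<close>, the fibres
    \<open>B a\<close> partition \<open>X\<close>.\<close>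
  have "sum_list s = (\<Sum>a\<in>A. card (B a))"
    using as by (simp add: s_def sum_list_distinct_conv_sum_set)
  also have "\<dots> = card (\<Union>a\<in>A. B a)"
    using finA finB by (subst card_UN_disjoint) (auto simp: B_def)
  also have "(\<Union>a\<in>A. B a) = X"
    using X by (auto simp: B_def A_def)
  also have "card X = n - c"
  proof -
    have "c = n - card X" unfolding c_def using X finX by (simp add: card_Diff_subset)
    moreover have "card X \<le> n" using card_mono[OF _ X] by simp
    ultimately show ?thesis by simp
  qed
  finally have "s \<in> compositions (card A) (n - c)"
    using Bge as distinct_card[of as] by (auto simp: compositions_def s_def)
  moreover have "c \<le> n"
    unfolding c_def using card_mono[of ?N "?N - X"] by simp
  moreover have "card Q \<le> prod_list s"
    using qB as prod.distinct_set_conv_list[OF as(2), of "\<lambda>a. card (B a)"] by (simp add: s_def)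
  ultimately show ?thesis
    using pc r unfolding band_data_def by blast
qed

section \<open>Upper bound: an embedding built from the data\<close>

text \<open>The disjoint union of blocks of sizes \<open>s ! k\<close> has \<open>m\<close>
  elements; a bijection onto it, followed by projection to the block index, is the required
  map.\<close>

lemma ex_map_with_fibre_sizes:
  assumes "s \<in> compositions r m"
  shows "\<exists>b. b \<in> {1..m} \<rightarrow> {..<r} \<and> (\<forall>k<r. card {x \<in> {1..m}. b x = k} = s ! k)"
proof -
  let ?S = "SIGMA k:{..<r}. {..<s ! k}"
  have "card ?S = m"
    using assms by (auto simp: compositions_def sum_list_sum_nth atLeast0LessThan)
  then obtain f where f: "bij_betw f {1..m} ?S"
    using finite_same_card_bij[of "{1..m}" ?S] by auto
  have "card {x \<in> {1..m}. fst (f x) = k} = s ! k" if k: "k < r" for k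
  proof -
    have "bij_betw f {x \<in> {1..m}. fst (f x) = k} ({k} \<times> {..<s ! k})"
      unfolding bij_betw_def
    proof
      show "inj_on f {x \<in> {1..m}. fst (f x) = k}"
        using f by (auto simp: bij_betw_def intro: inj_on_subset)
      have im: "f ` {1..m} = ?S" using f by (simp add: bij_betw_def)
      show "f ` {x \<in> {1..m}. fst (f x) = k} = {k} \<times> {..<s ! k}"
      proof (intro equalityI subsetI)
        fix z assume "z \<in> f ` {x \<in> {1..m}. fst (f x) = k}"
        then have "z \<in> ?S" "fst z = k" using im by blast+
        then show "z \<in> {k} \<times> {..<s ! k}" by auto
      next
        fix z assume z: "z \<in> {k} \<times> {..<s ! k}"
        then have "z \<in> f ` {1..m}" unfolding im using k by auto
        then obtain x where "x \<in> {1..m}" "z = f x" by blast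
        then show "z \<in> f ` {x \<in> {1..m}. fst (f x) = k}" using z by auto
      qed
    qed
    then show ?thesis by (auto dest: bij_betw_same_card)
  qed
  moreover have "(fst \<circ> f) \<in> {1..m} \<rightarrow> {..<r}"
  proof
    fix x assume "x \<in> {1..m}"
    then have "f x \<in> ?S" using f by (rule bij_betwE[THEN bspec, rotated])
    then show "(fst \<circ> f) x \<in> {..<r}" by auto
  qed
  ultimately show ?thesis by (intro exI[of _ "fst \<circ> f"]) simp
qed

lemma embedding_of_band_data:
  fixes P :: "'a set" and Q :: "'b set"
  assumes fin: "finite P" "finite Q" and bd: "band_data r (card P) (card Q) n"
  shows "\<exists>h. semigroup_embedding (P \<times> Q) rect_mult (full_trans n) (trans_mult n) h"
proof -
  obtain s c where s: "s \<in> compositions r (n - c)" and cn: "c \<le> n"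
    and q: "card Q \<le> prod_list s" and p: "card P \<le> r ^ c"
    using bd unfolding band_data_def by blast
  define m where "m = n - c"
  have len: "length s = r" using s by (simp add: compositions_def)
  obtain b where b: "b \<in> {1..m} \<rightarrow> {..<r}"
    and fib: "\<And>k. k < r \<Longrightarrow> card {x \<in> {1..m}. b x = k} = s ! k"
    using ex_map_with_fibre_sizes[OF s] unfolding m_def by blast
  \<comment> \<open>\<open>T\<close> consists of the transversals of the blocks of \<open>b\<close>,
    the candidates for images; \<open>U\<close> consists of the attachments of the last
    \<open>c\<close> points to blocks, the candidates for kernels.\<close>
  define T where "T = (\<Pi>\<^sub>E k\<in>{..<r}. {x \<in> {1..m}. b x = k})"
  define U where "U = ({m<..n} \<rightarrow>\<^sub>E {..<r})"
  have "card T = (\<Prod>k<r. s ! k)"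
    unfolding T_def using fib by (subst card_PiE) (auto intro!: prod.cong)
  also have "\<dots> = prod_list s"
    by (simp add: prod.list_conv_set_nth len atLeast0LessThan)
  finally have "card Q \<le> card T" using q by simp
  moreover have "finite T" unfolding T_def by (intro finite_PiE) auto
  ultimately obtain t where t: "t ` Q \<subseteq> T" "inj_on t Q"
    using card_le_inj[OF fin(2)] by blast
  have "card U = r ^ c" unfolding U_def m_def using cn by (simp add: card_PiE)
  moreover have "finite U" unfolding U_def by (intro finite_PiE) auto
  ultimately obtain u where u: "u ` P \<subseteq> U" "inj_on u P"
    using card_le_inj[OF fin(1)] p by metis
  \<comment> \<open>\<open>w i x\<close> is the block that \<open>x\<close> belongs to or is
    attached to; \<open>h (i, j)\<close> moves \<open>x\<close> to the point of the transversal
    \<open>t j\<close> in that block.\<close>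
  define w where "w i x = (if x \<le> m then b x else u i x)" for i x
  define h where "h = (\<lambda>(i, j). \<lambda>x\<in>{1..n}. t j (w i x))"
  have mn: "m \<le> n" by (simp add: m_def)
  have uU: "u i \<in> U" if "i \<in> P" for i using u(1) that by blast
  have tT: "t j \<in> T" if "j \<in> Q" for j using t(1) that by blast
  have w: "w i x < r" if "i \<in> P" "x \<in> {1..n}" for i x
    using that b uU[of i] by (auto simp: w_def U_def Pi_iff PiE_iff)
  have tk: "t j k \<in> {1..m}" "b (t j k) = k" if "j \<in> Q" "k < r" for j k
    using that tT[of j] by (auto simp: T_def PiE_iff)
  \<comment> \<open>Transversal points lie in \<open>{1..m}\<close>, where \<open>w i\<close> is
    \<open>b\<close> whatever \<open>i\<close> is. This is what makes products collapse as in a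
    rectangular band.\<close>
  have wt: "w i (t j k) = k" if "j \<in> Q" "k < r" for i j k
    using tk[OF that] by (simp add: w_def)
  have h: "h (i, j) x = t j (w i x)" if "x \<in> {1..n}" for i j x
    using that by (simp add: h_def)
  have hN: "h (i, j) x \<in> {1..n}" if "i \<in> P" "j \<in> Q" "x \<in> {1..n}" for i j x
    using tk(1)[OF that(2) w[OF that(1,3)]] h[OF that(3)] mn by auto
  have "semigroup_embedding (P \<times> Q) rect_mult (full_trans n) (trans_mult n) h"
    unfolding semigroup_embedding_def
  proof (intro conjI ballI)
    show "h \<in> P \<times> Q \<rightarrow> full_trans n"
    proof
      fix z assume "z \<in> P \<times> Q"
      then obtain i j where z: "z = (i, j)" "i \<in> P" "j \<in> Q" by blast
      show "h z \<in> full_trans n"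
        unfolding full_trans_def using hN[OF z(2,3)] z(1)
        by (intro PiE_I) (auto simp: h_def)
    qed
  next
    show "inj_on h (P \<times> Q)"
    proof (rule inj_onI, clarify)
      fix i j k l assume ij: "i \<in> P" "j \<in> Q" and kl: "k \<in> P" "l \<in> Q" and eq: "h (i, j) = h (k, l)"
      have eqx: "t j (w i x) = t l (w k x)" if "x \<in> {1..n}" for x
        using h[OF that] eq by metis
      \<comment> \<open>Evaluating both maps at the point \<open>t j a\<close>, which lies in block
        \<open>a\<close> for \<open>i\<close> and for \<open>k\<close> alike, recovers the
        transversal.\<close>
      have "t j a = t l a" if a: "a < r" for a
      proof -
        have "t j a \<in> {1..n}" using tk(1)[OF ij(2) a] mn by auto
        from eqx[OF this] show ?thesis
          by (simp add: wt[OF ij(2) a])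
      qed
      then have "t j = t l"
        using tT[OF ij(2)] tT[OF kl(2)] unfolding T_def by (intro PiE_ext) auto
      then have jl: "j = l" using t(2) ij kl by (auto dest: inj_onD)
      \<comment> \<open>Applying \<open>b\<close> undoes \<open>t j\<close> and recovers the block
        of \<open>x\<close>.\<close>
      have "u i x = u k x" if x: "x \<in> {m<..n}" for x
      proof -
        have xn: "x \<in> {1..n}" using x by auto
        have "b (t j (w i x)) = b (t j (w k x))" using eqx[OF xn] jl by simp
        then have "w i x = w k x" using tk(2) ij kl w xn by simp
        then show ?thesis using x by (simp add: w_def)
      qed
      then have "u i = u k"
        using uU[OF ij(1)] uU[OF kl(1)] unfolding U_def by (intro PiE_ext) auto
      then have "i = k" using u(2) ij kl by (auto dest: inj_onD)
      with jl show "i = k \<and> j = l" by simp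
    qed
  next
    fix y z assume "y \<in> P \<times> Q" "z \<in> P \<times> Q"
    then obtain i j k l where ij: "y = (i, j)" "i \<in> P" "j \<in> Q" and kl: "z = (k, l)" "k \<in> P" "l \<in> Q"
      by blast
    show "h (rect_mult y z) = trans_mult n (h y) (h z)"
    proof
      fix x
      show "h (rect_mult y z) x = trans_mult n (h y) (h z) x"
      proof (cases "x \<in> {1..n}")
        case True
        have "h (k, l) (h (i, j) x) = t l (w k (t j (w i x)))"
          using h[OF hN[OF ij(2,3) True]] h[OF True] by simp
        also have "\<dots> = h (i, l) x"
          using wt[OF ij(3) w[OF ij(2) True]] h[OF True] by simp
        finally show ?thesis
          using True by (simp add: ij kl rect_mult_def trans_mult_def compose_def)
      next
        \<comment> \<open>Outside \<open>{1..n}\<close> both sides are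
          \<open>undefined\<close>.\<close>
        case False
        then show ?thesis
          by (auto simp: ij kl rect_mult_def trans_mult_def compose_def h_def)
      qed
    qed
  qed
  then show ?thesis by blast
qed

theorem theorem3p9:
  fixes p q :: nat and P :: "'a set" and Q :: "'b set"
  assumes "p \<ge> 2" and "q \<ge> 2"
    and "finite P" and "card P = p"
    and "finite Q" and "card Q = q"
  shows "semigroup_degree (P \<times> Q) rect_mult = beta p q"
proof -
  \<comment> \<open>The degree and \<open>beta\<close> are then least elements of the same
    set.\<close>
  have "1 \<le> n \<and> (\<exists>h. semigroup_embedding (P \<times> Q) rect_mult (full_trans n) (trans_mult n) h)
          \<longleftrightarrow> (\<exists>r\<ge>2. band_data r p q n)" for n
  proof
    assume "1 \<le> n \<and> (\<exists>h. semigroup_embedding (P \<times> Q) rect_mult (full_trans n) (trans_mult n) h)"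
    then show "\<exists>r\<ge>2. band_data r p q n"
      using band_data_of_embedding[of P Q n] assms by auto
  next
    assume "\<exists>r\<ge>2. band_data r p q n"
    then obtain r where r: "r \<ge> 2" "band_data r p q n" by blast
    then obtain s c where "s \<in> compositions r (n - c)"
      unfolding band_data_def by blast
    \<comment> \<open>With \<open>r \<ge> 2\<close> this supplies \<open>1 \<le> n\<close>.\<close>
    then have "r \<le> n - c"
      using length_le_sum_list[of s] by (auto simp: compositions_def)
    with r show "1 \<le> n \<and> (\<exists>h. semigroup_embedding (P \<times> Q) rect_mult (full_trans n) (trans_mult n) h)"
      using embedding_of_band_data[of P Q r n] assms by auto
  qed
  then show ?thesis
    unfolding semigroup_degree_def
    using beta_eq_Least_band_data[of p q] assms by simp
qed

end
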